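(* (Hodge decomposition.) Let $C^0,\dots,C^d$ be the graph cochain spaces of a finite clique complex, with data-driven coboundaries $\mathsf{d}_k=\mathbf{B}_{k+1}\delta_k\mathbf{B}_k^{-1}$, codifferentials $\mathsf{d}_k^*=\mathbf{D}_k^{-1}\delta_k^*\mathbf{D}_{k+1}$, and Hodge Laplacians $\Delta_k=\mathsf{d}_{k-1}\mathsf{d}_{k-1}^*+\mathsf{d}_k^*\mathsf{d}_k$, where $\mathbf{B}_k,\mathbf{D}_k$ are diagonal with positive diagonal entries. Then for every $0\le k\le d$, $$C^k=\operatorname{im}(\mathsf{d}_{k-1})\ \oplus\ \ker(\Delta_k)\ \oplus\ \operatorname{im}(\mathsf{d}_k^* ),$$ where the three summands are mutually orthogonal with respect to the inner product $(\mathbf{x},\mathbf{y})_k:=\mathbf{x}^{T}\mathbf{D}_k\mathbf{B}_k^{-1}\mathbf{y}$ on $C^k$.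
   Context: Fix $d\ge 1$, a finite node set, and a finite family of cliques (nonempty sets of at most $d+1$ nodes) that is closed under taking nonempty subsets (a simplicial complex). $C^k$ is the finite-dimensional real vector space of $k$-cochains: alternating real-valued functions $\phi$ on ordered $(k+1)$-cliques, $\phi_{i_{\pi(0)}\cdots i_{\pi(k)}}=\operatorname{sgn}(\pi)\,\phi_{i_0\cdots i_k}$. Fixing one orientation for each $(k+1)$-clique identifies $C^k$ with $\mathbb{R}^{N_k}$, where $N_k$ is the number of $(k+1)$-cliques; diagonal matrices and transposes are taken in these coordinates. The coboundary $\delta_k:C^k\to C^{k+1}$ is $$(\delta_k\phi)_{i_0\cdots i_{k+1}}=\sum_{j=0}^{k+1}(-1)^j\phi_{i_0\cdots\widehat{i_j}\cdots i_{k+1}},$$ which satisfies $\delta_{k+1}\circ\delta_k=0$, and $\delta_k^*:C^{k+1}\to C^k$ is its transpose. For $0\le k\le d$, $\mathbf{B}_k$ and $\mathbf{D}_k$ are arbitrary diagonal matrices with positive diagonal entries acting on $C^k$. Convention: $C^{-1}=C^{d+1}=0$, so $\mathsf{d}_{-1}$, $\mathsf{d}_{-1}^*$, $\mathsf{d}_d$, $\mathsf{d}_d^*$ are zero maps. *)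

theory Defs
  imports
    "Jordan_Normal_Form.Gauss_Jordan_Elimination"
    "HOL-Combinatorics.Permutations"
    "HOL-Library.Function_Algebras"
begin

definition clique_complex :: "nat \<Rightarrow> 'a set \<Rightarrow> 'a set set \<Rightarrow> bool" where
  "clique_complex d V K \<longleftrightarrow>
     finite V \<and>
     (\<forall>s\<in>K. s \<noteq> {} \<and> s \<subseteq> V \<and> card s \<le> d + 1) \<and>
     (\<forall>s\<in>K. \<forall>t. t \<noteq> {} \<longrightarrow> t \<subseteq> s \<longrightarrow> t \<in> K)"

text \<open>
  Degrees are integers. In degree \<open>- 1\<close> (and in degree \<open>d + 1\<close>) a clique complex has no
  ordered cliques, since \<open>K\<close> contains neither the empty set nor a set of \<open>d + 2\<close> nodes,
  so that the convention $C^{-1} = C^{d+1} = 0$ is built in.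
\<close>

definition ordered_cliques :: "'a set set \<Rightarrow> int \<Rightarrow> 'a list set" where
  "ordered_cliques K k = {xs. distinct xs \<and> int (length xs) = k + 1 \<and> set xs \<in> K}"

text \<open>
  A cochain is a function on ordered cliques; it is extended by zero to all other lists.
  The list \<open>permute_list \<pi> [i\<^sub>0, \<dots>, i\<^sub>k]\<close> is \<open>[i\<^bsub>\<pi>(0)\<^esub>, \<dots>, i\<^bsub>\<pi>(k)\<^esub>]\<close>. Addition and zero
  of cochains are those of \<open>HOL-Library.Function_Algebras\<close>.
\<close>

type_synonym 'a cochain = "'a list \<Rightarrow> real"

definition cochains :: "'a set set \<Rightarrow> int \<Rightarrow> 'a cochain set" where
  "cochains K k = {\<phi>.
     (\<forall>xs. xs \<notin> ordered_cliques K k \<longrightarrow> \<phi> xs = 0) \<and>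
     (\<forall>xs \<in> ordered_cliques K k. \<forall>\<pi>. \<pi> permutes {..<length xs} \<longrightarrow>
        \<phi> (permute_list \<pi> xs) = of_int (sign \<pi>) * \<phi> xs)}"

definition coboundary :: "'a set set \<Rightarrow> int \<Rightarrow> 'a cochain \<Rightarrow> 'a cochain" where
  "coboundary K k \<phi> = (\<lambda>xs.
     if xs \<in> ordered_cliques K (k + 1)
     then \<Sum>j<length xs. (- 1) ^ j * \<phi> (take j xs @ drop (Suc j) xs)
     else 0)"

text \<open>
  A choice of one orientation for each clique of \<open>k + 1\<close> nodes, for all \<open>k\<close>. The oriented cliques
  are listed as \<open>\<omega> k\<close>, so that cochains of degree \<open>k\<close> have coordinates \<open>0, \<dots>, length (\<omega> k) - 1\<close>.
\<close>

definition orientation :: "'a set set \<Rightarrow> (int \<Rightarrow> 'a list list) \<Rightarrow> bool" where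
  "orientation K \<omega> \<longleftrightarrow> (\<forall>k.
     distinct (\<omega> k) \<and> set (\<omega> k) \<subseteq> ordered_cliques K k \<and>
     bij_betw set (set (\<omega> k)) {s \<in> K. int (card s) = k + 1})"

definition coords :: "(int \<Rightarrow> 'a list list) \<Rightarrow> int \<Rightarrow> 'a cochain \<Rightarrow> real vec" where
  "coords \<omega> k \<phi> = vec (length (\<omega> k)) (\<lambda>i. \<phi> (\<omega> k ! i))"

text \<open>The alternating function with value 1 on \<open>ys\<close>, vanishing off the reorderings of \<open>ys\<close>.\<close>

definition basis_cochain :: "'a list \<Rightarrow> 'a cochain" where
  "basis_cochain ys = (\<lambda>xs.
     \<Sum>\<pi> | \<pi> permutes {..<length ys} \<and> permute_list \<pi> ys = xs. of_int (sign \<pi>))"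

definition of_coords :: "(int \<Rightarrow> 'a list list) \<Rightarrow> int \<Rightarrow> real vec \<Rightarrow> 'a cochain" where
  "of_coords \<omega> k v = (\<lambda>xs. \<Sum>i<length (\<omega> k). v $ i * basis_cochain (\<omega> k ! i) xs)"

text \<open>
  The coordinates given by an orientation identify the cochains of degree \<open>k\<close> with real vectors,
  with inverse \<open>of_coords\<close>.
\<close>

lemma basis_cochain_permute:
  assumes "distinct ys" "\<pi> permutes {..<length ys}"
  shows "basis_cochain ys (permute_list \<pi> ys) = of_int (sign \<pi>)"
proof -
  have "{\<sigma>. \<sigma> permutes {..<length ys} \<and> permute_list \<sigma> ys = permute_list \<pi> ys} = {\<pi>}"
  proof (intro equalityI subsetI; clarsimp simp: assms(2))
    fix \<sigma> assume s: "\<sigma> permutes {..<length ys}" and e: "permute_list \<sigma> ys = permute_list \<pi> ys"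
    show "\<sigma> = \<pi>"
    proof
      fix i show "\<sigma> i = \<pi> i"
      proof (cases "i < length ys")
        case True
        then have "ys ! \<sigma> i = ys ! \<pi> i"
          using permute_list_nth[OF s] permute_list_nth[OF assms(2)] e by simp
        moreover have "\<sigma> i < length ys" "\<pi> i < length ys"
          using True permutes_in_image[OF s, of i] permutes_in_image[OF assms(2), of i] by simp_all
        ultimately show ?thesis using assms(1) nth_eq_iff_index_eq by blast
      next
        case False
        then show ?thesis using s assms(2) by (metis lessThan_iff permutes_not_in)
      qed
    qed
  qed
  then show ?thesis by (simp add: basis_cochain_def)
qed

lemma basis_cochain_eq_0:
  assumes "\<nexists>\<pi>. \<pi> permutes {..<length ys} \<and> permute_list \<pi> ys = xs"
  shows "basis_cochain ys xs = 0"
proof -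
  have "{\<pi>. \<pi> permutes {..<length ys} \<and> permute_list \<pi> ys = xs} = {}"
    using assms by blast
  then show ?thesis unfolding basis_cochain_def by (metis sum.empty)
qed

lemma basis_cochain_eq_0':
  assumes "set xs \<noteq> set ys"
  shows "basis_cochain ys xs = 0"
proof (rule basis_cochain_eq_0, rule notI, elim exE conjE)
  fix \<pi> assume "\<pi> permutes {..<length ys}" "permute_list \<pi> ys = xs"
  then have "set xs = set ys" using set_permute_list by blast
  then show False using assms by simp
qed

lemma distinct_same_set_permute:
  assumes "distinct xs" "distinct ys" "set xs = set ys"
  obtains \<pi> where "\<pi> permutes {..<length ys}" "permute_list \<pi> ys = xs"
  using assms mset_eq_permutation set_eq_iff_mset_eq_distinct by metis

lemma permute_list_ordered_cliques:
  assumes "\<pi> permutes {..<length xs}" 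
  shows "permute_list \<pi> xs \<in> ordered_cliques K k \<longleftrightarrow> xs \<in> ordered_cliques K k"
  using assms by (simp add: ordered_cliques_def)

lemma basis_cochain_in_cochains:
  assumes ys: "ys \<in> ordered_cliques K k"
  shows "basis_cochain ys \<in> cochains K k"
  unfolding cochains_def
proof (clarify, intro conjI allI ballI impI)
  fix xs assume "xs \<notin> ordered_cliques K k"
  then show "basis_cochain ys xs = 0"
    using ys permute_list_ordered_cliques by (intro basis_cochain_eq_0) blast
next
  have dy: "distinct ys" using ys by (simp add: ordered_cliques_def)
  fix xs \<pi> assume xs: "xs \<in> ordered_cliques K k" and p: "\<pi> permutes {..<length xs}"
  have len: "length xs = length ys" and dx: "distinct xs"
    using xs ys by (auto simp: ordered_cliques_def)
  show "basis_cochain ys (permute_list \<pi> xs) = of_int (sign \<pi>) * basis_cochain ys xs"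
  proof (cases "set xs = set ys")
    case True
    then obtain \<sigma> where s: "\<sigma> permutes {..<length ys}" "permute_list \<sigma> ys = xs"
      using distinct_same_set_permute dx dy by metis
    have "permute_list \<pi> xs = permute_list (\<sigma> \<circ> \<pi>) ys"
      using s p len by (simp add: permute_list_compose)
    moreover have "sign (\<sigma> \<circ> \<pi>) = sign \<sigma> * sign \<pi>"
      using s p by (intro sign_compose permutes_imp_permutation) auto
    moreover have "\<sigma> \<circ> \<pi> permutes {..<length ys}"
      using s p len by (simp add: permutes_compose)
    ultimately show ?thesis
      using basis_cochain_permute[OF dy] s by (metis mult.commute of_int_mult)
  next
    case False
    have "basis_cochain ys xs = 0"
      using False by (rule basis_cochain_eq_0')
    moreover have "basis_cochain ys (permute_list \<pi> xs) = 0"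
      using False p by (intro basis_cochain_eq_0') simp
    ultimately show ?thesis by simp
  qed
qed

lemma basis_cochain_orientation:
  assumes "orientation K \<omega>" "i < length (\<omega> k)" "j < length (\<omega> k)"
  shows "basis_cochain (\<omega> k ! i) (\<omega> k ! j) = (if i = j then 1 else 0)"
proof (cases "i = j")
  case True
  have "distinct (\<omega> k ! j)" using assms nth_mem
    unfolding orientation_def ordered_cliques_def by blast
  from basis_cochain_permute[OF this permutes_id] show ?thesis using True by (simp add: sign_id)
next
  case False
  have "inj_on set (set (\<omega> k))" "distinct (\<omega> k)"
    using assms unfolding orientation_def bij_betw_def by auto
  then have "set (\<omega> k ! i) \<noteq> set (\<omega> k ! j)"
    using False assms(2,3) by (metis inj_onD nth_eq_iff_index_eq nth_mem)
  then have "basis_cochain (\<omega> k ! i) (\<omega> k ! j) = 0"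
    by (intro basis_cochain_eq_0') simp
  then show ?thesis using False by simp
qed

lemma of_coords_in_cochains:
  assumes "orientation K \<omega>"
  shows "of_coords \<omega> k v \<in> cochains K k"
proof -
  have b: "basis_cochain (\<omega> k ! i) \<in> cochains K k" if "i < length (\<omega> k)" for i
  proof (rule basis_cochain_in_cochains)
    show "\<omega> k ! i \<in> ordered_cliques K k"
      using assms nth_mem[OF that] unfolding orientation_def by blast
  qed
  show ?thesis
    unfolding cochains_def
  proof (intro CollectI conjI allI ballI impI)
    fix xs assume "xs \<notin> ordered_cliques K k"
    then have "basis_cochain (\<omega> k ! i) xs = 0" if "i < length (\<omega> k)" for i
      using b[OF that] by (simp add: cochains_def)
    then show "of_coords \<omega> k v xs = 0"
      by (simp add: of_coords_def)
  next
    fix xs \<pi> assume "xs \<in> ordered_cliques K k" "\<pi> permutes {..<length xs}"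
    then have "basis_cochain (\<omega> k ! i) (permute_list \<pi> xs) =
        of_int (sign \<pi>) * basis_cochain (\<omega> k ! i) xs" if "i < length (\<omega> k)" for i
      using b[OF that] unfolding cochains_def by blast
    then show "of_coords \<omega> k v (permute_list \<pi> xs) = of_int (sign \<pi>) * of_coords \<omega> k v xs"
      by (simp add: of_coords_def sum_distrib_left mult.left_commute)
  qed
qed

lemma coords_of_coords:
  assumes "orientation K \<omega>" "v \<in> carrier_vec (length (\<omega> k))"
  shows "coords \<omega> k (of_coords \<omega> k v) = v"
proof (rule eq_vecI)
  show "dim_vec (coords \<omega> k (of_coords \<omega> k v)) = dim_vec v"
    using carrier_vecD[OF assms(2)] by (simp add: coords_def)
next
  fix i assume "i < dim_vec v"
  then have i: "i < length (\<omega> k)" using carrier_vecD[OF assms(2)] by simp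
  have "of_coords \<omega> k v (\<omega> k ! i) = (\<Sum>l<length (\<omega> k). if l = i then v $ l else 0)"
    unfolding of_coords_def
    by (rule sum.cong) (simp_all add: basis_cochain_orientation[OF assms(1) _ i])
  also have "\<dots> = v $ i"
    using i by simp
  finally show "coords \<omega> k (of_coords \<omega> k v) $ i = v $ i"
    using i by (simp add: coords_def)
qed

lemma cochain_eqI:
  assumes o: "orientation K \<omega>" and "\<phi> \<in> cochains K k" "\<psi> \<in> cochains K k"
    and c: "coords \<omega> k \<phi> = coords \<omega> k \<psi>"
  shows "\<phi> = \<psi>"
proof
  fix xs
  show "\<phi> xs = \<psi> xs"
  proof (cases "xs \<in> ordered_cliques K k")
    case False
    then show ?thesis using assms by (simp add: cochains_def)
  next
    case True
    then have "set xs \<in> {s \<in> K. int (card s) = k + 1}"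
      by (auto simp: ordered_cliques_def distinct_card)
    then have "set xs \<in> set ` set (\<omega> k)"
      using o unfolding orientation_def bij_betw_def by blast
    then obtain i where i: "i < length (\<omega> k)" "set xs = set (\<omega> k ! i)"
      by (auto simp: in_set_conv_nth)
    have y: "\<omega> k ! i \<in> ordered_cliques K k"
      using o i nth_mem unfolding orientation_def by blast
    obtain \<pi> where p: "\<pi> permutes {..<length (\<omega> k ! i)}" "permute_list \<pi> (\<omega> k ! i) = xs"
      using distinct_same_set_permute True y i unfolding ordered_cliques_def by blast
    have "\<phi> (\<omega> k ! i) = \<psi> (\<omega> k ! i)"
      using c i unfolding coords_def by (metis index_vec)
    moreover have "\<phi> xs = of_int (sign \<pi>) * \<phi> (\<omega> k ! i)" "\<psi> xs = of_int (sign \<pi>) * \<psi> (\<omega> k ! i)"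
      using assms(2,3) p y unfolding cochains_def by blast+
    ultimately show ?thesis by simp
  qed
qed

lemma bij_betw_coords:
  assumes "orientation K \<omega>"
  shows "bij_betw (coords \<omega> k) (cochains K k) (carrier_vec (length (\<omega> k)))"
proof (rule bij_betw_byWitness[where f' = "of_coords \<omega> k"])
  have c: "coords \<omega> k \<phi> \<in> carrier_vec (length (\<omega> k))" for \<phi>
    by (simp add: coords_def)
  show "coords \<omega> k ` cochains K k \<subseteq> carrier_vec (length (\<omega> k))"
    using c by blast
  show "of_coords \<omega> k ` carrier_vec (length (\<omega> k)) \<subseteq> cochains K k"
    using of_coords_in_cochains[OF assms] by blast
  show "\<forall>v\<in>carrier_vec (length (\<omega> k)). coords \<omega> k (of_coords \<omega> k v) = v"
    using coords_of_coords[OF assms] by blast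
  show "\<forall>\<phi>\<in>cochains K k. of_coords \<omega> k (coords \<omega> k \<phi>) = \<phi>"
    using cochain_eqI[OF assms of_coords_in_cochains[OF assms] _ coords_of_coords[OF assms c]]
    by blast
qed

definition mat_action ::
  "(int \<Rightarrow> 'a list list) \<Rightarrow> int \<Rightarrow> int \<Rightarrow> real mat \<Rightarrow> 'a cochain \<Rightarrow> 'a cochain" where
  "mat_action \<omega> k l A \<phi> = of_coords \<omega> l (A *\<^sub>v coords \<omega> k \<phi>)"

definition coboundary_mat :: "'a set set \<Rightarrow> (int \<Rightarrow> 'a list list) \<Rightarrow> int \<Rightarrow> real mat" where
  "coboundary_mat K \<omega> k = mat (length (\<omega> (k + 1))) (length (\<omega> k))
     (\<lambda>(i, j). coboundary K k (basis_cochain (\<omega> k ! j)) (\<omega> (k + 1) ! i))"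

definition coboundary_transpose ::
  "'a set set \<Rightarrow> (int \<Rightarrow> 'a list list) \<Rightarrow> int \<Rightarrow> 'a cochain \<Rightarrow> 'a cochain" where
  "coboundary_transpose K \<omega> k =
     mat_action \<omega> (k + 1) k (transpose_mat (coboundary_mat K \<omega> k))"

definition pos_diagonal_mat :: "nat \<Rightarrow> real mat \<Rightarrow> bool" where
  "pos_diagonal_mat n A \<longleftrightarrow> A \<in> carrier_mat n n \<and> diagonal_mat A \<and> (\<forall>i<n. 0 < A $$ (i, i))"

definition inv_mat :: "real mat \<Rightarrow> real mat" where
  "inv_mat A = the (mat_inverse A)"

text \<open>
  The data-driven coboundary $B_{k+1} \delta_k B_k^{-1}$ and codifferential
  $D_k^{-1} \delta_k^* D_{k+1}$; both are zero in degrees \<open>k = - 1\<close> and \<open>k = d\<close>.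
\<close>

definition dd_coboundary ::
  "nat \<Rightarrow> 'a set set \<Rightarrow> (int \<Rightarrow> 'a list list) \<Rightarrow> (int \<Rightarrow> real mat) \<Rightarrow> int \<Rightarrow> 'a cochain \<Rightarrow> 'a cochain"
where
  "dd_coboundary d K \<omega> B k \<phi> =
     (if 0 \<le> k \<and> k < int d
      then mat_action \<omega> (k + 1) (k + 1) (B (k + 1))
             (coboundary K k (mat_action \<omega> k k (inv_mat (B k)) \<phi>))
      else 0)"

definition codifferential ::
  "nat \<Rightarrow> 'a set set \<Rightarrow> (int \<Rightarrow> 'a list list) \<Rightarrow> (int \<Rightarrow> real mat) \<Rightarrow> int \<Rightarrow> 'a cochain \<Rightarrow> 'a cochain"
where
  "codifferential d K \<omega> D k \<psi> =
     (if 0 \<le> k \<and> k < int d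
      then mat_action \<omega> k k (inv_mat (D k))
             (coboundary_transpose K \<omega> k (mat_action \<omega> (k + 1) (k + 1) (D (k + 1)) \<psi>))
      else 0)"

definition hodge_laplacian ::
  "nat \<Rightarrow> 'a set set \<Rightarrow> (int \<Rightarrow> 'a list list) \<Rightarrow> (int \<Rightarrow> real mat) \<Rightarrow> (int \<Rightarrow> real mat) \<Rightarrow>
   int \<Rightarrow> 'a cochain \<Rightarrow> 'a cochain"
where
  "hodge_laplacian d K \<omega> B D k \<phi> =
     dd_coboundary d K \<omega> B (k - 1) (codifferential d K \<omega> D (k - 1) \<phi>) +
     codifferential d K \<omega> D k (dd_coboundary d K \<omega> B k \<phi>)"

definition cochain_inner ::
  "(int \<Rightarrow> 'a list list) \<Rightarrow> (int \<Rightarrow> real mat) \<Rightarrow> (int \<Rightarrow> real mat) \<Rightarrow>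
   int \<Rightarrow> 'a cochain \<Rightarrow> 'a cochain \<Rightarrow> real"
where
  "cochain_inner \<omega> B D k x y =
     coords \<omega> k x \<bullet> ((D k * inv_mat (B k)) *\<^sub>v coords \<omega> k y)"

text \<open>
  Internal direct sum of three subspaces: the addition map is a bijection from their product
  onto the whole space.
\<close>

definition direct_sum3 :: "'b::ab_group_add set \<Rightarrow> 'b set \<Rightarrow> 'b set \<Rightarrow> 'b set \<Rightarrow> bool" where
  "direct_sum3 W U\<^sub>1 U\<^sub>2 U\<^sub>3 \<longleftrightarrow> bij_betw (\<lambda>(u\<^sub>1, u\<^sub>2, u\<^sub>3). u\<^sub>1 + u\<^sub>2 + u\<^sub>3) (U\<^sub>1 \<times> U\<^sub>2 \<times> U\<^sub>3) W"

definition orthogonal_sets :: "('b \<Rightarrow> 'b \<Rightarrow> real) \<Rightarrow> 'b set \<Rightarrow> 'b set \<Rightarrow> bool" where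
  "orthogonal_sets ip U U' \<longleftrightarrow> (\<forall>u\<in>U. \<forall>u'\<in>U'. ip u u' = 0)"

end

theory Submission
  imports Defs "Jordan_Normal_Form.Determinant"
begin

text \<open>
  The inner product $(x, y)_k = x^T D_k B_k^{-1} y$ is chosen so that the codifferential is the
  adjoint of the data-driven coboundary $d_k$: both $(d_k x, y)_{k+1}$ and $(x, d_k^* y)_k$ equal
  $x^T B_k^{-1} \delta_k^* D_{k+1} y$ (\<open>weighted_inner_adjoint\<close>). Moreover $d_{k+1} d_k = 0$, because
  the factors $B_{k+1}^{-1} B_{k+1}$ between the two coboundaries cancel and
  $\delta_{k+1} \delta_k = 0$ (\<open>dd_dd\<close>). From then on only linear algebra of a three-term complex
  $U \to V \to W$ with adjoint maps is involved (\<open>hodge_decomposition\<close>).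

  In such a complex the images of $d_{k-1}$ and $d_k^*$ are orthogonal, as
  $(d_{k-1} u, d_k^* w) = (d_k d_{k-1} u, w) = 0$. Hence the two summands of the Laplacian at a
  harmonic $h$ are orthogonal, so both vanish, and adjointness gives $d_{k-1}^* h = 0$ and
  $d_k h = 0$ (\<open>harmonic_iff\<close>). Harmonic cochains are therefore orthogonal to both images.
  Conversely, what remains of a cochain after subtracting its orthogonal projections to the two
  images is orthogonal to both, so it is killed by the adjoint maps and is harmonic. Orthogonality
  makes the sum direct. The projections exist because cochain spaces are spanned by the finitely many
  cochains that belong to the oriented cliques (\<open>orthogonal_projection\<close>, \<open>span_basis_cochains\<close>).

  In the extreme degrees \<open>k = 0\<close> and \<open>k = d\<close> one neighbour of $C^k$ is a zero space. Every form is
  definite there, which is why the abstract decomposition asks for definiteness only on the spaces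
  of the complex and not on the ambient space of all functions.
\<close>

section \<open>Orthogonal projection and the abstract Hodge decomposition\<close>

text \<open>
  A bilinear form on an ambient space, positive definite on the subspace \<open>C\<close> only: a weighted sum
  over oriented cliques does not see the values of a function on other lists, so on the space of all
  functions it is degenerate.
\<close>

locale definite_form = Vector_Spaces.vector_space scale
  for scale :: "real \<Rightarrow> 'b::ab_group_add \<Rightarrow> 'b" +
  fixes C :: "'b set" and ip :: "'b \<Rightarrow> 'b \<Rightarrow> real"
  assumes subspace_C: "subspace C"
    and ip_add_left: "ip (x + y) z = ip x z + ip y z"
    and ip_scale_left: "ip (scale c x) z = c * ip x z"
    and ip_commute: "ip x y = ip y x"
    and ip_pos: "x \<in> C \<Longrightarrow> x \<noteq> 0 \<Longrightarrow> 0 < ip x x"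
begin

lemma ip_add_right: "ip x (y + z) = ip x y + ip x z"
  by (metis ip_add_left ip_commute)

lemma ip_scale_right: "ip x (scale c y) = c * ip x y"
  by (metis ip_scale_left ip_commute)

lemma ip_zero_left [simp]: "ip 0 y = 0"
  using ip_scale_left[of 0 0 y] by simp

lemma ip_zero_right [simp]: "ip x 0 = 0"
  by (metis ip_zero_left ip_commute)

lemma ip_diff_left: "ip (x - y) z = ip x z - ip y z"
  using ip_add_left[of "x - y" y z] by simp

lemma ip_self_eq_0: "x \<in> C \<Longrightarrow> ip x x = 0 \<Longrightarrow> x = 0"
  using ip_pos by fastforce

lemma ip_span_eq_0:
  assumes "\<And>e. e \<in> E \<Longrightarrow> ip x e = 0" and "y \<in> span E"
  shows "ip x y = 0"
  using assms(2)
proof (induction rule: span_induct_alt)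
  case (step c e z)
  then show ?case using assms(1) by (simp add: ip_add_right ip_scale_right)
qed simp

text \<open>
  The Gram--Schmidt step: when a vector \<open>a\<close> is added to the spanning set, the projection to the
  old span is corrected along the part \<open>b\<close> of \<open>a\<close> that is orthogonal to it.
\<close>

lemma orthogonal_projection:
  assumes "finite E" and "E \<subseteq> C" and "x \<in> C"
  shows "\<exists>p \<in> span E. \<forall>y \<in> span E. ip (x - p) y = 0"
proof -
  have "\<exists>p \<in> span E. \<forall>e \<in> E. ip (x - p) e = 0"
    using assms
  proof (induction E arbitrary: x rule: finite_induct)
    case empty
    then show ?case by (auto intro: bexI[of _ 0])
  next
    case (insert a E)
    then obtain p where p: "p \<in> span E" "\<And>e. e \<in> E \<Longrightarrow> ip (x - p) e = 0"
      by (metis insert_subset)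
    from insert obtain q where q: "q \<in> span E" "\<And>e. e \<in> E \<Longrightarrow> ip (a - q) e = 0"
      by (metis insert_subset)
    define b where "b = a - q"
    define c where "c = ip (x - p) b / ip b b"
    have q': "q \<in> C"
      using q insert.prems subspace_C span_minimal by blast
    then have bC: "b \<in> C"
      using insert.prems subspace_C by (simp add: b_def subspace_diff)
    \<comment> \<open>If \<open>a\<close> lies in the old span, then \<open>b\<close> is zero, and so is \<open>c\<close> as a quotient by zero.\<close>
    have c: "ip (x - p) b = c * ip b b"
      using ip_self_eq_0[OF bC] by (cases "b = 0") (auto simp: c_def)
    have ins: "span E \<subseteq> span (insert a E)"
      by (rule span_mono) blast
    have "b \<in> span (insert a E)"
      using ins q unfolding b_def by (intro span_diff[OF span_base]) auto
    then have mem: "p + scale c b \<in> span (insert a E)"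
      using ins p by (intro span_add span_scale) auto
    have orth: "ip (x - (p + scale c b)) e = 0" if "e \<in> E" for e
      using p(2)[OF that] q(2)[OF that]
      by (simp add: ip_diff_left ip_add_left ip_scale_left b_def)
    then have "ip (x - (p + scale c b)) q = 0"
      using ip_span_eq_0 q(1) by blast
    moreover have "ip (x - (p + scale c b)) b = 0"
      using c by (simp add: ip_diff_left ip_add_left ip_scale_left)
    ultimately have "ip (x - (p + scale c b)) a = 0"
      using ip_add_right[of "x - (p + scale c b)" b q] by (simp add: b_def)
    with orth mem show ?case by blast
  qed
  then show ?thesis using ip_span_eq_0 by blast
qed

lemma orthogonal_sum3_unique:
  assumes sub: "subspace X" "subspace Y" "subspace Z" "X \<subseteq> C" "Y \<subseteq> C" "Z \<subseteq> C"
    and orth: "orthogonal_sets ip X Y" "orthogonal_sets ip X Z" "orthogonal_sets ip Y Z"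
    and mem: "x \<in> X" "x' \<in> X" "y \<in> Y" "y' \<in> Y" "z \<in> Z" "z' \<in> Z"
    and eq: "x + y + z = x' + y' + z'"
  shows "x = x' \<and> y = y' \<and> z = z'"
proof -
  define u v w where "u = x - x'" and "v = y - y'" and "w = z - z'"
  have m: "u \<in> X" "v \<in> Y" "w \<in> Z"
    using sub mem by (simp_all add: u_def v_def w_def subspace_diff)
  have s: "u + v + w = 0"
    using eq by (simp add: u_def v_def w_def algebra_simps)
  have o: "ip u v = 0" "ip u w = 0" "ip v w = 0" "ip v u = 0" "ip w u = 0" "ip w v = 0"
    using orth m ip_commute unfolding orthogonal_sets_def by metis+
  have "ip (u + v + w) u = 0" "ip (u + v + w) v = 0" "ip (u + v + w) w = 0"
    unfolding s by simp_all
  then have "ip u u = 0" "ip v v = 0" "ip w w = 0"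
    using o by (simp_all add: ip_add_left)
  then have "u = 0" "v = 0" "w = 0"
    using ip_self_eq_0 m sub by blast+
  then show ?thesis by (simp add: u_def v_def w_def)
qed

end

text \<open>
  A complex $U \to V \to W$ with maps \<open>d\<close> and \<open>d'\<close> whose adjoints are \<open>s\<close> and \<open>s'\<close>. The finite sets
  \<open>E\<close> and \<open>F\<close> make the two images in \<open>V\<close> finite-dimensional, so that one can project to them.
\<close>

locale adjoint_complex =
  U: definite_form scale U ipU + V: definite_form scale V ipV + W: definite_form scale W ipW +
  d: Vector_Spaces.linear scale scale d + d': Vector_Spaces.linear scale scale d' +
  s: Vector_Spaces.linear scale scale s + s': Vector_Spaces.linear scale scale s'
  for scale :: "real \<Rightarrow> 'b::ab_group_add \<Rightarrow> 'b"
    and U V W :: "'b set" and ipU ipV ipW :: "'b \<Rightarrow> 'b \<Rightarrow> real" and d s d' s' :: "'b \<Rightarrow> 'b" +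
  fixes E F :: "'b set"
  assumes E: "finite E" "U.span E = U" and F: "finite F" "U.span F = W"
    and d: "u \<in> U \<Longrightarrow> d u \<in> V" and d': "v \<in> V \<Longrightarrow> d' v \<in> W"
    and s: "v \<in> V \<Longrightarrow> s v \<in> U" and s': "w \<in> W \<Longrightarrow> s' w \<in> V"
    and complex: "u \<in> U \<Longrightarrow> d' (d u) = 0"
    and adj: "u \<in> U \<Longrightarrow> v \<in> V \<Longrightarrow> ipV (d u) v = ipU u (s v)"
    and adj': "v \<in> V \<Longrightarrow> w \<in> W \<Longrightarrow> ipW (d' v) w = ipV v (s' w)"
begin

definition harmonic :: "'b set" where
  "harmonic = {v \<in> V. d (s v) + s' (d' v) = 0}"

lemma orthogonal_images: "orthogonal_sets ipV (d ` U) (s' ` W)"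
  unfolding orthogonal_sets_def
proof (intro ballI, elim imageE, simp only:)
  fix u w assume "u \<in> U" "w \<in> W"
  then show "ipV (d u) (s' w) = 0"
    using adj'[of "d u" w] complex d by simp
qed

text \<open>
  The two summands of the Laplacian lie in orthogonal images, so if their sum vanishes, each of them
  does; then $(s v, s v) = (v, d (s v)) = 0$, and likewise for \<open>d'\<close>.
\<close>

lemma harmonic_iff: "v \<in> harmonic \<longleftrightarrow> v \<in> V \<and> s v = 0 \<and> d' v = 0"
proof
  assume "v \<in> harmonic"
  then have v: "v \<in> V" and z: "d (s v) + s' (d' v) = 0"
    by (simp_all add: harmonic_def)
  have o: "ipV (d (s v)) (s' (d' v)) = 0"
    using orthogonal_images v s d' unfolding orthogonal_sets_def by blast
  have "ipV (d (s v) + s' (d' v)) (d (s v)) = 0" "ipV (d (s v) + s' (d' v)) (s' (d' v)) = 0"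
    unfolding z by simp_all
  then have "ipV (d (s v)) (d (s v)) = 0" "ipV (s' (d' v)) (s' (d' v)) = 0"
    using o V.ip_commute[of "s' (d' v)" "d (s v)"] by (simp_all add: V.ip_add_left)
  then have dz: "d (s v) = 0" "s' (d' v) = 0"
    using v s d d' s' V.ip_self_eq_0 by blast+
  have "ipU (s v) (s v) = 0" "ipW (d' v) (d' v) = 0"
    using adj[of "s v" v] adj'[of v "d' v"] dz v s d' by simp_all
  then show "v \<in> V \<and> s v = 0 \<and> d' v = 0"
    using v s d' U.ip_self_eq_0 W.ip_self_eq_0 by blast
qed (simp add: harmonic_def)

lemma orthogonal_harmonic:
  "orthogonal_sets ipV (d ` U) harmonic" "orthogonal_sets ipV harmonic (s' ` W)"
proof -
  have "ipV (d u) h = 0" if "u \<in> U" "h \<in> harmonic" for u h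
    using adj[of u h] that by (simp add: harmonic_iff)
  then show "orthogonal_sets ipV (d ` U) harmonic"
    by (auto simp: orthogonal_sets_def)
  have "ipV h (s' w) = 0" if "h \<in> harmonic" "w \<in> W" for h w
    using adj'[of h w] that by (simp add: harmonic_iff)
  then show "orthogonal_sets ipV harmonic (s' ` W)"
    by (auto simp: orthogonal_sets_def)
qed

lemma image_span: "d ` U = U.span (d ` E)" "s' ` W = U.span (s' ` F)"
  using d.span_image[of E] s'.span_image[of F] E F by simp_all

text \<open>
  Since the images are orthogonal, subtracting the projection to the second one does not disturb
  orthogonality to the first. The remainder \<open>h\<close> is orthogonal to both images, in particular to
  \<open>d (s h)\<close> and \<open>s' (d' h)\<close>, which forces \<open>s h\<close> and \<open>d' h\<close> to vanish.
\<close>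

lemma decomposition:
  assumes x: "x \<in> V"
  shows "\<exists>u \<in> d ` U. \<exists>h \<in> harmonic. \<exists>w \<in> s' ` W. x = u + h + w"
proof -
  have "d ` E \<subseteq> V"
    using E d U.span_superset by blast
  then obtain p where p: "p \<in> d ` U" "\<And>y. y \<in> d ` U \<Longrightarrow> ipV (x - p) y = 0"
    using V.orthogonal_projection[of "d ` E" x] E x image_span by auto
  have "s' ` F \<subseteq> V"
    using F s' U.span_superset by blast
  moreover have xp: "x - p \<in> V"
    using p d x V.subspace_C by (blast intro: U.subspace_diff)
  ultimately obtain q where q: "q \<in> s' ` W" "\<And>y. y \<in> s' ` W \<Longrightarrow> ipV (x - p - q) y = 0"
    using V.orthogonal_projection[of "s' ` F" "x - p"] F image_span by auto
  define h where "h = x - p - q"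
  have h: "h \<in> V"
    using xp q s' V.subspace_C unfolding h_def by (blast intro: U.subspace_diff)
  have "ipV (d u) h = 0" if "u \<in> U" for u
  proof -
    have "ipV (d u) q = 0"
      using orthogonal_images that q unfolding orthogonal_sets_def by blast
    then show ?thesis
      using p(2)[of "d u"] that unfolding h_def by (simp add: V.ip_diff_left V.ip_commute[of "d u"])
  qed
  then have "ipU (s h) (s h) = 0"
    using adj s h by simp
  moreover have "ipW (d' h) (d' h) = 0"
    using adj'[of h "d' h"] q(2)[of "s' (d' h)"] d' h by (simp add: h_def)
  ultimately have "h \<in> harmonic"
    using h s d' U.ip_self_eq_0 W.ip_self_eq_0 by (simp add: harmonic_iff)
  moreover have "x = p + h + q"
    by (simp add: h_def)
  ultimately show ?thesis using p(1) q(1) by blast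
qed

theorem hodge_decomposition: "direct_sum3 V (d ` U) harmonic (s' ` W)"
proof -
  have sub: "U.subspace (d ` U)" "U.subspace (s' ` W)"
    by (simp_all add: image_span)
  have subh: "U.subspace harmonic"
    using V.subspace_C
    by (simp add: U.subspace_def harmonic_iff s.add s.scale d'.add d'.scale)
  have V: "d ` U \<subseteq> V" "harmonic \<subseteq> V" "s' ` W \<subseteq> V"
    using d s' by (auto simp: harmonic_def)
  show ?thesis
    unfolding direct_sum3_def bij_betw_def
  proof (intro conjI equalityI subsetI)
    note unique = V.orthogonal_sum3_unique[OF sub(1) subh sub(2) V orthogonal_harmonic(1)
        orthogonal_images orthogonal_harmonic(2)]
    show "inj_on (\<lambda>(u, h, w). u + h + w) (d ` U \<times> harmonic \<times> s' ` W)"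
    proof (rule inj_onI, elim SigmaE, simp only: prod.case prod.inject)
      fix u h w u' h' w'
      assume "u \<in> d ` U" "h \<in> harmonic" "w \<in> s' ` W" "u' \<in> d ` U" "h' \<in> harmonic" "w' \<in> s' ` W"
        "u + h + w = u' + h' + w'"
      then show "u = u' \<and> h = h' \<and> w = w'" by (intro unique)
    qed
  next
    fix x assume "x \<in> (\<lambda>(u, h, w). u + h + w) ` (d ` U \<times> harmonic \<times> s' ` W)"
    then obtain u h w where "x = u + h + w" "u \<in> V" "h \<in> V" "w \<in> V"
      using V by fast
    then show "x \<in> V" using V.subspace_C U.subspace_add by blast
  next
    fix x assume "x \<in> V"
    then obtain u h w where "u \<in> d ` U" "h \<in> harmonic" "w \<in> s' ` W" "x = u + h + w"
      using decomposition by blast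
    then show "x \<in> (\<lambda>(u, h, w). u + h + w) ` (d ` U \<times> harmonic \<times> s' ` W)"
      by (intro image_eqI[of _ _ "(u, h, w)"]) auto
  qed
qed

end

section \<open>The coboundary maps cochains to cochains and squares to zero\<close>

abbreviation face :: "nat \<Rightarrow> 'a list \<Rightarrow> 'a list" where
  "face j xs \<equiv> take j xs @ drop (Suc j) xs"

lemma nth_face:
  assumes "i < length xs - 1" "j < length xs"
  shows "face j xs ! i = xs ! insert_index j i"
  using assms by (auto simp: nth_append insert_index_def)

lemma face_face:
  assumes "i \<le> j" "Suc j < length xs"
  shows "face i (face (Suc j) xs) = face j (face i xs)"
  using assms by (intro nth_equalityI) (auto simp: nth_append)

lemma face_ordered_cliques:
  assumes K: "clique_complex d V K" and xs: "xs \<in> ordered_cliques K (k + 1)"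
    and k: "0 \<le> k" and j: "j < length xs"
  shows "face j xs \<in> ordered_cliques K k"
proof -
  have len: "int (length xs) = k + 2" and dist: "distinct xs" and sK: "set xs \<in> K"
    using xs by (auto simp: ordered_cliques_def)
  have "length (face j xs) = length xs - 1"
    using j by simp
  then have len': "int (length (face j xs)) = k + 1"
    using len k by linarith
  then have "face j xs \<noteq> []"
    using k by auto
  moreover have sub: "set (face j xs) \<subseteq> set xs"
    using set_take_subset[of j xs] set_drop_subset[of "Suc j" xs] by auto
  ultimately have "set (face j xs) \<in> K"
    using K sK unfolding clique_complex_def by (metis set_empty)
  moreover have "distinct (face j xs)"
    using dist set_take_disj_set_drop_if_distinct[OF dist, of j "Suc j"] by simp
  ultimately show ?thesis
    using len' by (simp add: ordered_cliques_def)
qed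

text \<open>
  Reordering a clique and then deleting a node is deleting that node first and reordering what is
  left. The reordering of the rest is the permutation obtained from \<open>\<pi>\<close> by crossing out row \<open>j\<close>
  and column \<open>\<pi> j\<close> of its matrix, as in the Laplace expansion of a determinant.
\<close>

lemma face_permute_list:
  assumes p: "\<pi> permutes {..<length xs}" and j: "j < length xs"
  shows "face j (permute_list \<pi> xs) = permute_list (permutation_delete \<pi> j) (face (\<pi> j) xs)"
    (is "_ = permute_list ?q _")
proof -
  obtain n where n: "length xs = Suc n"
    using j by (cases xs) auto
  have q: "?q permutes {..<n}"
    using permutation_delete_permutes[of \<pi> n j] p j n by (simp add: atLeast0LessThan)
  have pj: "\<pi> j < length xs"
    using p j permutes_in_image[OF p] by auto
  have len: "length (face (\<pi> j) xs) = n"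
    using pj n by simp
  show ?thesis
  proof (rule nth_equalityI)
    show "length (face j (permute_list \<pi> xs)) = length (permute_list ?q (face (\<pi> j) xs))"
      using j len n by simp
  next
    fix i assume "i < length (face j (permute_list \<pi> xs))"
    then have i: "i < n"
      using j n by simp
    then have ii: "insert_index j i < length xs"
      using n by (simp add: insert_index_def)
    have "\<pi> (insert_index j i) \<noteq> \<pi> j"
      using permutes_inj[OF p] insert_index_exclude[of j i] by (metis injD)
    then have del: "insert_index (\<pi> j) (?q i) = \<pi> (insert_index j i)"
      by (simp add: permutation_delete_def delete_ran_def delete_dom_def insert_delete_index)
    have qi: "?q i < n"
      using permutes_in_image[OF q] i by auto
    have "face j (permute_list \<pi> xs) ! i = xs ! \<pi> (insert_index j i)"
      using i j n ii nth_face[of i "permute_list \<pi> xs" j] permute_list_nth[OF p ii] by simp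
    also have "\<dots> = face (\<pi> j) xs ! ?q i"
      using nth_face[of "?q i" xs "\<pi> j"] qi pj n del by simp
    also have "\<dots> = permute_list ?q (face (\<pi> j) xs) ! i"
      using permute_list_nth[of ?q "face (\<pi> j) xs" i] q len i by simp
    finally show "face j (permute_list \<pi> xs) ! i = permute_list ?q (face (\<pi> j) xs) ! i" .
  qed
qed

lemma sign_permutation_delete:
  assumes p: "p permutes {..<n}" and j: "j < n"
  shows "(of_int (sign (permutation_delete p j)) :: real) = (- 1) ^ (j + p j) * of_int (sign p)"
proof -
  obtain m where n: "n = Suc m"
    using j by (cases n) auto
  have pj: "p j < Suc m"
    using permutes_in_image[OF p, of j] j n by simp
  have "permutation_delete p j permutes {0..<m}"
    using permutation_delete_permutes p j n by (simp add: atLeast0LessThan)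
  then have "(of_int (sign (permutation_insert j (p j) (permutation_delete p j))) :: real)
      = (- 1) ^ (j + p j) * of_int (sign (permutation_delete p j))"
    using signof_permutation_insert j pj n by blast
  moreover have "permutation_insert j (p j) (permutation_delete p j) = p"
    using permutation_insert_delete[of p m j] p j n by (simp add: atLeast0LessThan)
  ultimately have "of_int (sign p) = (- 1) ^ (j + p j) * (of_int (sign (permutation_delete p j)) :: real)"
    by simp
  then show ?thesis
    by (simp add: mult.assoc[symmetric] power_mult_distrib[symmetric])
qed

text \<open>
  Crossing out row \<open>j\<close> and column \<open>\<pi> j\<close> changes the sign of \<open>\<pi>\<close> by $(-1)^{j + \pi(j)}$. This turns the sign $(-1)^j$ of the \<open>j\<close>-th
  face of the reordered clique into the sign $(-1)^{\pi(j)}$ with which the same nodes occur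
  as a face of the original one, up to the factor \<open>sign \<pi>\<close>.
\<close>

lemma coboundary_in_cochains:
  assumes K: "clique_complex d V K" and k: "0 \<le> k" and \<phi>: "\<phi> \<in> cochains K k"
  shows "coboundary K k \<phi> \<in> cochains K (k + 1)"
  unfolding cochains_def
proof (intro CollectI conjI allI ballI impI)
  fix xs \<pi> assume xs: "xs \<in> ordered_cliques K (k + 1)" and p: "\<pi> permutes {..<length xs}"
  have xs': "permute_list \<pi> xs \<in> ordered_cliques K (k + 1)"
    using permute_list_ordered_cliques[OF p] xs by blast
  have summand: "(- 1) ^ j * \<phi> (face j (permute_list \<pi> xs))
      = of_int (sign \<pi>) * ((- 1) ^ \<pi> j * \<phi> (face (\<pi> j) xs))" if j: "j < length xs" for j
  proof -
    have pj: "\<pi> j < length xs"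
      using permutes_in_image[OF p, of j] j by simp
    have len: "length (face (\<pi> j) xs) = length xs - 1"
      using pj by simp
    have Suc_len: "Suc (length xs - 1) = length xs"
      using j by simp
    have q: "permutation_delete \<pi> j permutes {..<length (face (\<pi> j) xs)}"
      using permutation_delete_permutes[of \<pi> "length xs - 1" j] p j
      unfolding len atLeast0LessThan Suc_len by simp
    have "\<phi> (face j (permute_list \<pi> xs))
        = of_int (sign (permutation_delete \<pi> j)) * \<phi> (face (\<pi> j) xs)"
      using \<phi> q face_ordered_cliques[OF K xs k pj] face_permute_list[OF p j]
      unfolding cochains_def by simp
    then show ?thesis
      using sign_permutation_delete[OF p j] by (simp add: power_add)
  qed
  have "coboundary K k \<phi> (permute_list \<pi> xs)
      = (\<Sum>j<length xs. of_int (sign \<pi>) * ((- 1) ^ \<pi> j * \<phi> (face (\<pi> j) xs)))"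
    using xs' summand by (simp add: coboundary_def)
  also have "\<dots> = of_int (sign \<pi>) * (\<Sum>j<length xs. (- 1) ^ \<pi> j * \<phi> (face (\<pi> j) xs))"
    by (simp add: sum_distrib_left)
  also have "(\<Sum>j<length xs. (- 1) ^ \<pi> j * \<phi> (face (\<pi> j) xs)) = (\<Sum>j<length xs. (- 1) ^ j * \<phi> (face j xs))"
    using sum.permute[OF p, of "\<lambda>j. (- 1) ^ j * \<phi> (face j xs)"] by (simp add: o_def)
  finally show "coboundary K k \<phi> (permute_list \<pi> xs) = of_int (sign \<pi>) * coboundary K k \<phi> xs"
    using xs by (simp add: coboundary_def)
qed (simp add: coboundary_def)

text \<open>
  Every pair of nodes is deleted in two orders. The set \<open>?A\<close> collects the terms in which the later
  node goes first, \<open>?B\<close> those in which the earlier one does; the two orders differ in the index of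
  one deletion by one, hence in sign.
\<close>

lemma coboundary_coboundary:
  assumes K: "clique_complex d V K" and k: "0 \<le> k"
  shows "coboundary K (k + 1) (coboundary K k \<phi>) = 0"
proof
  fix xs
  show "coboundary K (k + 1) (coboundary K k \<phi>) xs = 0 xs"
  proof (cases "xs \<in> ordered_cliques K (k + 1 + 1)")
    case True
    define n where "n = length xs - 1"
    have n: "length xs = Suc n"
      using True k by (simp add: ordered_cliques_def n_def) linarith
    define f where "f = (\<lambda>j i. (- 1) ^ (j + i) * \<phi> (face i (face j xs)))"
    let ?A = "{(j, i). i < j \<and> j < Suc n}" and ?B = "{(j, i). j \<le> i \<and> i < n}"
    have fin: "finite ?A" "finite ?B"
      by (rule finite_subset[of _ "{..Suc n} \<times> {..Suc n}"]; auto)+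
    have "coboundary K k \<phi> (face j xs) = (\<Sum>i<n. (- 1) ^ i * \<phi> (face i (face j xs)))"
      if "j < length xs" for j
      using face_ordered_cliques[OF K True _ that] k that n by (simp add: coboundary_def)
    then have "coboundary K (k + 1) (coboundary K k \<phi>) xs = (\<Sum>j<Suc n. \<Sum>i<n. f j i)"
      using True n by (simp add: coboundary_def f_def sum_distrib_left power_add mult.assoc del: sum.lessThan_Suc)
    also have "\<dots> = (\<Sum>(j, i)\<in>{..<Suc n} \<times> {..<n}. f j i)"
      by (rule sum.cartesian_product)
    also have "{..<Suc n} \<times> {..<n} = ?A \<union> ?B"
      by auto
    also have "(\<Sum>(j, i)\<in>?A \<union> ?B. f j i) = (\<Sum>(j, i)\<in>?A. f j i) + (\<Sum>(j, i)\<in>?B. f j i)"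
      using fin by (intro sum.union_disjoint) auto
    also have "(\<Sum>(j, i)\<in>?A. f j i) = (\<Sum>(j, i)\<in>?B. - f j i)"
    proof (rule sum.reindex_bij_witness[of _ "\<lambda>(j, i). (Suc i, j)" "\<lambda>(j, i). (i, j - 1)"], goal_cases)
      case (5 a)
      then obtain i j where a: "a = (Suc j, i)" "i \<le> j" "j < n"
        by (cases a, case_tac "fst a") auto
      then have "face i (face (Suc j) xs) = face j (face i xs)"
        by (intro face_face) (use a n in auto)
      then show ?case
        unfolding a by (simp add: f_def add.commute)
    qed auto
    finally show ?thesis
      by (simp add: split_def sum_negf)
  qed (simp add: coboundary_def)
qed

section \<open>Cochain spaces as vector spaces, and diagonal matrices\<close>

abbreviation (input) scale_cochain :: "real \<Rightarrow> 'a cochain \<Rightarrow> 'a cochain" where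
  "scale_cochain c \<phi> \<equiv> (\<lambda>xs. c * \<phi> xs)"

global_interpretation cochain: Vector_Spaces.vector_space scale_cochain
  by unfold_locales (auto simp: fun_eq_iff algebra_simps)

lemma subspace_cochains: "cochain.subspace (cochains K k)"
  unfolding cochain.subspace_def cochains_def by (auto simp: algebra_simps)

lemma cochains_trivial:
  assumes K: "clique_complex d V K" and k: "\<not> (0 \<le> k \<and> k \<le> int d)"
  shows "cochains K k = {0}"
proof -
  have "ordered_cliques K k = {}"
  proof (rule ccontr)
    assume "ordered_cliques K k \<noteq> {}"
    then obtain xs where xs: "distinct xs" "int (length xs) = k + 1" "set xs \<in> K"
      by (auto simp: ordered_cliques_def)
    then have "set xs \<noteq> {}" "length xs \<le> d + 1"
      using K distinct_card[OF xs(1)] unfolding clique_complex_def by metis+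
    then have "0 < length xs" "length xs \<le> d + 1"
      by auto
    then show False using xs(2) k by linarith
  qed
  then show ?thesis by (auto simp: cochains_def fun_eq_iff)
qed

lemma cochain_eqI_nth:
  assumes "orientation K \<omega>" "\<phi> \<in> cochains K k" "\<psi> \<in> cochains K k"
    and "\<And>i. i < length (\<omega> k) \<Longrightarrow> \<phi> (\<omega> k ! i) = \<psi> (\<omega> k ! i)"
  shows "\<phi> = \<psi>"
  using assms by (intro cochain_eqI[OF assms(1-3)]) (auto simp: coords_def)

lemma of_coords_nth:
  assumes "orientation K \<omega>" "v \<in> carrier_vec (length (\<omega> k))" "i < length (\<omega> k)"
  shows "of_coords \<omega> k v (\<omega> k ! i) = v $ i"
  using arg_cong[OF coords_of_coords[OF assms(1,2)], of "\<lambda>v. v $ i"] assms(3)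
  by (simp add: coords_def)

text \<open>Supplies the finite spanning sets needed for orthogonal projection.\<close>

lemma span_basis_cochains:
  assumes o: "orientation K \<omega>"
  shows "cochain.span (basis_cochain ` set (\<omega> k)) = cochains K k"
proof (rule antisym)
  have "basis_cochain ` set (\<omega> k) \<subseteq> cochains K k"
    using o basis_cochain_in_cochains unfolding orientation_def by blast
  then show "cochain.span (basis_cochain ` set (\<omega> k)) \<subseteq> cochains K k"
    by (rule cochain.span_minimal) (rule subspace_cochains)
next
  show "cochains K k \<subseteq> cochain.span (basis_cochain ` set (\<omega> k))"
  proof
    fix \<phi> assume \<phi>: "\<phi> \<in> cochains K k"
    have "\<phi> = of_coords \<omega> k (coords \<omega> k \<phi>)"
      using of_coords_nth[OF o, of "coords \<omega> k \<phi>" k]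
      by (intro cochain_eqI_nth[OF o \<phi> of_coords_in_cochains[OF o]]) (simp add: coords_def)
    also have "\<dots> = (\<Sum>i<length (\<omega> k). scale_cochain (coords \<omega> k \<phi> $ i) (basis_cochain (\<omega> k ! i)))"
    proof
      have sum_apply: "(\<Sum>i\<in>I. f i) xs = (\<Sum>i\<in>I. f i xs)"
        for f :: "nat \<Rightarrow> 'a cochain" and I xs
        by (induction I rule: infinite_finite_induct) auto
      show "of_coords \<omega> k (coords \<omega> k \<phi>) xs
        = (\<Sum>i<length (\<omega> k). scale_cochain (coords \<omega> k \<phi> $ i) (basis_cochain (\<omega> k ! i))) xs" for xs
        by (simp add: of_coords_def sum_apply)
    qed
    also have "\<dots> \<in> cochain.span (basis_cochain ` set (\<omega> k))"
      by (intro cochain.span_sum cochain.span_scale cochain.span_base) auto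
    finally show "\<phi> \<in> cochain.span (basis_cochain ` set (\<omega> k))" .
  qed
qed

lemma pos_diagonal_mat_eq:
  assumes "pos_diagonal_mat n A"
  shows "A = mat_diag n (\<lambda>i. A $$ (i, i))"
  using assms by (intro eq_matI) (auto simp: pos_diagonal_mat_def diagonal_mat_def mat_diag_def)

lemma inv_pos_diagonal_mat:
  assumes A: "pos_diagonal_mat n A"
  shows "inv_mat A = mat_diag n (\<lambda>i. 1 / A $$ (i, i))"
proof -
  define a where "a = (\<lambda>i. A $$ (i, i))"
  define C where "C = mat_diag n (\<lambda>i. 1 / a i)"
  have c: "A \<in> carrier_mat n n" and C: "C \<in> carrier_mat n n"
    using A by (auto simp: pos_diagonal_mat_def C_def)
  have Aa: "A = mat_diag n a"
    using pos_diagonal_mat_eq[OF A] by (simp add: a_def)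
  have a: "a i \<noteq> 0" if "i < n" for i
    using A that unfolding pos_diagonal_mat_def a_def by fastforce
  then have inv: "C * A = 1\<^sub>m n" "A * C = 1\<^sub>m n"
    unfolding Aa C_def mat_diag_diag by (auto simp: mat_diag_def intro!: eq_matI)
  then have "A \<in> Units (ring_mat TYPE(real) n ())"
    unfolding Units_def ring_mat_simps using c C by blast
  then have "mat_inverse A \<noteq> None"
    using mat_inverse(1)[OF c, where b = "()"] by argo
  then obtain B where B: "mat_inverse A = Some B"
    by blast
  then have AB: "A * B = 1\<^sub>m n" and Bc: "B \<in> carrier_mat n n"
    using mat_inverse(2)[OF c] by blast+
  have "B = C * A * B"
    using inv Bc by simp
  also have "\<dots> = C * (A * B)"
    by (rule assoc_mult_mat[OF C c Bc])
  also have "\<dots> = C"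
    using AB C by simp
  finally show ?thesis
    using B by (simp add: inv_mat_def C_def a_def)
qed

lemma mat_diag_mult_vec_nth:
  fixes f :: "nat \<Rightarrow> real"
  assumes "i < n" "v \<in> carrier_vec n"
  shows "(mat_diag n f *\<^sub>v v) $ i = f i * v $ i"
proof -
  have "(mat_diag n f *\<^sub>v v) $ i = (\<Sum>j\<in>{0..<n}. (if i = j then f j else 0) * v $ j)"
    using assms by (simp add: scalar_prod_def mat_diag_def)
  also have "\<dots> = (\<Sum>j\<in>{0..<n}. if j = i then f i * v $ i else 0)"
    by (intro sum.cong refl) simp
  also have "\<dots> = f i * v $ i"
    using assms(1) by simp
  finally show ?thesis .
qed

lemma mat_action_nth:
  assumes "orientation K \<omega>" and A: "A \<in> carrier_mat (length (\<omega> l)) n" and "i < length (\<omega> l)"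
  shows "mat_action \<omega> k l A \<phi> (\<omega> l ! i) = (A *\<^sub>v coords \<omega> k \<phi>) $ i"
proof -
  have "A *\<^sub>v coords \<omega> k \<phi> \<in> carrier_vec (length (\<omega> l))"
    by (rule carrier_vecI) (simp only: dim_mult_mat_vec carrier_matD(1)[OF A])
  then show ?thesis
    unfolding mat_action_def by (rule of_coords_nth[OF assms(1) _ assms(3)])
qed

lemma mat_action_diag_nth:
  assumes "orientation K \<omega>" and i: "i < length (\<omega> k)"
  shows "mat_action \<omega> k k (mat_diag (length (\<omega> k)) f) \<phi> (\<omega> k ! i) = f i * \<phi> (\<omega> k ! i)"
proof -
  have "coords \<omega> k \<phi> \<in> carrier_vec (length (\<omega> k))"
    by (simp add: coords_def)
  then have "(mat_diag (length (\<omega> k)) f *\<^sub>v coords \<omega> k \<phi>) $ i = f i * coords \<omega> k \<phi> $ i"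
    by (rule mat_diag_mult_vec_nth[OF i])
  then show ?thesis
    using i mat_action_nth[OF assms(1) mat_diag_dim i, of k f \<phi>] by (simp add: coords_def)
qed

lemma coboundary_of_coords_nth:
  assumes "orientation K \<omega>" and i: "i < length (\<omega> (k + 1))"
  shows "coboundary K k (of_coords \<omega> k v) (\<omega> (k + 1) ! i)
    = (\<Sum>j<length (\<omega> k). coboundary_mat K \<omega> k $$ (i, j) * v $ j)"
proof -
  let ?ys = "\<omega> (k + 1) ! i" and ?b = "\<lambda>j. basis_cochain (\<omega> k ! j)"
  have ys: "?ys \<in> ordered_cliques K (k + 1)"
    using assms nth_mem[OF i] unfolding orientation_def by blast
  then have "coboundary K k (of_coords \<omega> k v) ?ys
      = (\<Sum>l<length ?ys. (- 1) ^ l * (\<Sum>j<length (\<omega> k). v $ j * ?b j (face l ?ys)))"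
    by (simp only: coboundary_def of_coords_def if_True)
  also have "\<dots> = (\<Sum>l<length ?ys. \<Sum>j<length (\<omega> k). (- 1) ^ l * ?b j (face l ?ys) * v $ j)"
    unfolding sum_distrib_left by (intro sum.cong refl) (simp only: mult_ac)
  also have "\<dots> = (\<Sum>j<length (\<omega> k). \<Sum>l<length ?ys. (- 1) ^ l * ?b j (face l ?ys) * v $ j)"
    by (rule sum.swap)
  also have "\<dots> = (\<Sum>j<length (\<omega> k). coboundary K k (?b j) ?ys * v $ j)"
    using ys by (simp only: coboundary_def if_True sum_distrib_right)
  also have "\<dots> = (\<Sum>j<length (\<omega> k). coboundary_mat K \<omega> k $$ (i, j) * v $ j)"
    using i by (intro sum.cong refl) (simp add: coboundary_mat_def)
  finally show ?thesis .
qed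

section \<open>The data-driven coboundary and codifferential in coordinates\<close>

locale data_driven_complex =
  fixes d :: nat and V :: "'a set" and K :: "'a set set"
    and \<omega> :: "int \<Rightarrow> 'a list list" and B D :: "int \<Rightarrow> real mat"
  assumes K: "clique_complex d V K"
    and orient: "orientation K \<omega>"
    and B: "0 \<le> j \<Longrightarrow> j \<le> int d \<Longrightarrow> pos_diagonal_mat (length (\<omega> j)) (B j)"
    and D: "0 \<le> j \<Longrightarrow> j \<le> int d \<Longrightarrow> pos_diagonal_mat (length (\<omega> j)) (D j)"
begin

abbreviation "dd \<equiv> dd_coboundary d K \<omega> B"
abbreviation "cod \<equiv> codifferential d K \<omega> D"
abbreviation "N k \<equiv> length (\<omega> k)"

lemma mat_action_B_nth:
  assumes "0 \<le> k" "k \<le> int d" "i < N k"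
  shows "mat_action \<omega> k k (B k) \<phi> (\<omega> k ! i) = B k $$ (i, i) * \<phi> (\<omega> k ! i)"
    "mat_action \<omega> k k (inv_mat (B k)) \<phi> (\<omega> k ! i) = \<phi> (\<omega> k ! i) / B k $$ (i, i)"
  using mat_action_diag_nth[OF orient assms(3), of "\<lambda>i. B k $$ (i, i)"]
    mat_action_diag_nth[OF orient assms(3), of "\<lambda>i. 1 / B k $$ (i, i)"]
    pos_diagonal_mat_eq[OF B[OF assms(1,2)]] inv_pos_diagonal_mat[OF B[OF assms(1,2)]]
  by simp_all

lemma mat_action_D_nth:
  assumes "0 \<le> k" "k \<le> int d" "i < N k"
  shows "mat_action \<omega> k k (D k) \<phi> (\<omega> k ! i) = D k $$ (i, i) * \<phi> (\<omega> k ! i)"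
    "mat_action \<omega> k k (inv_mat (D k)) \<phi> (\<omega> k ! i) = \<phi> (\<omega> k ! i) / D k $$ (i, i)"
  using mat_action_diag_nth[OF orient assms(3), of "\<lambda>i. D k $$ (i, i)"]
    mat_action_diag_nth[OF orient assms(3), of "\<lambda>i. 1 / D k $$ (i, i)"]
    pos_diagonal_mat_eq[OF D[OF assms(1,2)]] inv_pos_diagonal_mat[OF D[OF assms(1,2)]]
  by simp_all

lemma diag_pos:
  assumes "0 \<le> k" "k \<le> int d" "i < N k"
  shows "0 < B k $$ (i, i)" "0 < D k $$ (i, i)"
  using B D assms unfolding pos_diagonal_mat_def by blast+

lemma zero_in_cochains: "0 \<in> cochains K k"
  using subspace_cochains cochain.subspace_0 by blast

lemma mat_action_in_cochains: "mat_action \<omega> l k A \<phi> \<in> cochains K k"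
  by (simp add: mat_action_def of_coords_in_cochains[OF orient])

lemma dd_in_cochains: "dd k \<phi> \<in> cochains K (k + 1)"
  by (simp add: dd_coboundary_def mat_action_in_cochains zero_in_cochains)

lemma cod_in_cochains: "cod k \<psi> \<in> cochains K k"
  by (simp add: codifferential_def mat_action_in_cochains zero_in_cochains)

lemma dd_nth:
  assumes k: "0 \<le> k" "k < int d" and i: "i < N (k + 1)"
  shows "dd k \<phi> (\<omega> (k + 1) ! i) = B (k + 1) $$ (i, i) *
    (\<Sum>j<N k. coboundary_mat K \<omega> k $$ (i, j) * (\<phi> (\<omega> k ! j) / B k $$ (j, j)))"
proof -
  let ?\<chi> = "mat_action \<omega> k k (inv_mat (B k)) \<phi>"
  have inv: "inv_mat (B k) \<in> carrier_mat (N k) (N k)"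
    using inv_pos_diagonal_mat[OF B, of k] k by simp
  have "coboundary K k ?\<chi> (\<omega> (k + 1) ! i)
    = (\<Sum>j<N k. coboundary_mat K \<omega> k $$ (i, j) * (inv_mat (B k) *\<^sub>v coords \<omega> k \<phi>) $ j)"
    unfolding mat_action_def by (rule coboundary_of_coords_nth[OF orient i])
  also have "\<dots> = (\<Sum>j<N k. coboundary_mat K \<omega> k $$ (i, j) * ?\<chi> (\<omega> k ! j))"
    by (intro sum.cong refl) (simp add: mat_action_nth[OF orient inv])
  also have "\<dots> = (\<Sum>j<N k. coboundary_mat K \<omega> k $$ (i, j) * (\<phi> (\<omega> k ! j) / B k $$ (j, j)))"
    using k by (intro sum.cong refl) (simp add: mat_action_B_nth)
  finally show ?thesis
    using k i by (simp add: dd_coboundary_def mat_action_B_nth)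
qed

lemma cod_nth:
  assumes k: "0 \<le> k" "k < int d" and j: "j < N k"
  shows "cod k \<psi> (\<omega> k ! j) =
    (\<Sum>i<N (k + 1). coboundary_mat K \<omega> k $$ (i, j) * (D (k + 1) $$ (i, i) * \<psi> (\<omega> (k + 1) ! i))) / D k $$ (j, j)"
proof -
  let ?\<chi> = "mat_action \<omega> (k + 1) (k + 1) (D (k + 1)) \<psi>"
  have M: "transpose_mat (coboundary_mat K \<omega> k) \<in> carrier_mat (N k) (N (k + 1))"
    by (simp add: coboundary_mat_def)
  have "coboundary_transpose K \<omega> k ?\<chi> (\<omega> k ! j)
    = (\<Sum>i<N (k + 1). coboundary_mat K \<omega> k $$ (i, j) * ?\<chi> (\<omega> (k + 1) ! i))"
    unfolding coboundary_transpose_def mat_action_nth[OF orient M j]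
    using j by (simp add: scalar_prod_def coords_def coboundary_mat_def atLeast0LessThan)
  also have "\<dots> = (\<Sum>i<N (k + 1). coboundary_mat K \<omega> k $$ (i, j) * (D (k + 1) $$ (i, i) * \<psi> (\<omega> (k + 1) ! i)))"
    using k by (intro sum.cong) (simp_all add: mat_action_D_nth)
  finally show ?thesis
    using k j by (simp add: codifferential_def mat_action_D_nth)
qed

lemma linear_dd: "Vector_Spaces.linear scale_cochain scale_cochain (dd k)"
proof (cases "0 \<le> k \<and> k < int d")
  case True
  have "dd k (\<phi> + \<psi>) = dd k \<phi> + dd k \<psi>" for \<phi> \<psi>
  proof (rule cochain_eqI_nth[OF orient dd_in_cochains])
    show "dd k \<phi> + dd k \<psi> \<in> cochains K (k + 1)"
      by (intro cochain.subspace_add subspace_cochains dd_in_cochains)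
  qed (use True in \<open>simp add: dd_nth distrib_left sum.distrib add_divide_distrib\<close>)
  moreover have "dd k (scale_cochain c \<phi>) = scale_cochain c (dd k \<phi>)" for c \<phi>
  proof (rule cochain_eqI_nth[OF orient dd_in_cochains])
    show "scale_cochain c (dd k \<phi>) \<in> cochains K (k + 1)"
      by (intro cochain.subspace_scale subspace_cochains dd_in_cochains)
  qed (use True in \<open>simp add: dd_nth sum_distrib_left mult_ac\<close>)
  ultimately show ?thesis
    using cochain.vector_space_axioms unfolding Vector_Spaces.linear_iff by blast
next
  case False
  then have "dd k = (\<lambda>_. 0)"
    by (auto simp: dd_coboundary_def)
  then show ?thesis
    using cochain.vector_space_axioms by (simp add: Vector_Spaces.linear_iff fun_eq_iff)
qed

lemma linear_cod: "Vector_Spaces.linear scale_cochain scale_cochain (cod k)"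
proof (cases "0 \<le> k \<and> k < int d")
  case True
  have "cod k (\<phi> + \<psi>) = cod k \<phi> + cod k \<psi>" for \<phi> \<psi>
  proof (rule cochain_eqI_nth[OF orient cod_in_cochains])
    show "cod k \<phi> + cod k \<psi> \<in> cochains K k"
      by (intro cochain.subspace_add subspace_cochains cod_in_cochains)
  qed (use True in \<open>simp add: cod_nth distrib_left sum.distrib add_divide_distrib\<close>)
  moreover have "cod k (scale_cochain c \<phi>) = scale_cochain c (cod k \<phi>)" for c \<phi>
  proof (rule cochain_eqI_nth[OF orient cod_in_cochains])
    show "scale_cochain c (cod k \<phi>) \<in> cochains K k"
      by (intro cochain.subspace_scale subspace_cochains cod_in_cochains)
  qed (use True in \<open>simp add: cod_nth sum_distrib_left mult_ac\<close>)
  ultimately show ?thesis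
    using cochain.vector_space_axioms unfolding Vector_Spaces.linear_iff by blast
next
  case False
  then have "cod k = (\<lambda>_. 0)"
    by (auto simp: codifferential_def)
  then show ?thesis
    using cochain.vector_space_axioms by (simp add: Vector_Spaces.linear_iff fun_eq_iff)
qed

text \<open>
  Cancelling $B_{k+1}^{-1} B_{k+1}$ passes through coordinates, which determine only alternating
  functions; this is where \<open>coboundary_in_cochains\<close> is used.
\<close>

lemma dd_dd: "dd (k + 1) (dd k \<phi>) = 0"
proof (cases "0 \<le> k \<and> k + 1 < int d")
  case True
  define \<chi> where "\<chi> = mat_action \<omega> k k (inv_mat (B k)) \<phi>"
  have k: "0 \<le> k" and k1: "0 \<le> k + 1" "k + 1 \<le> int d"
    using True by auto
  have c: "coboundary K k \<chi> \<in> cochains K (k + 1)"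
    using coboundary_in_cochains[OF K k] mat_action_in_cochains by (simp add: \<chi>_def)
  have "mat_action \<omega> (k + 1) (k + 1) (inv_mat (B (k + 1)))
      (mat_action \<omega> (k + 1) (k + 1) (B (k + 1)) (coboundary K k \<chi>)) = coboundary K k \<chi>"
    using diag_pos(1)[OF k1]
    by (intro cochain_eqI_nth[OF orient mat_action_in_cochains c])
      (fastforce simp: mat_action_B_nth[OF k1])
  then have "dd (k + 1) (dd k \<phi>) = mat_action \<omega> (k + 1 + 1) (k + 1 + 1) (B (k + 1 + 1)) 0"
    using True coboundary_coboundary[OF K k, of \<chi>] by (simp add: dd_coboundary_def \<chi>_def)
  also have "\<dots> = 0"
    using True mat_action_B_nth(1)[of "k + 1 + 1"]
    by (intro cochain_eqI_nth[OF orient mat_action_in_cochains zero_in_cochains]) simp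
  finally show ?thesis .
next
  case False
  then have "dd k = (\<lambda>_. 0) \<or> dd (k + 1) = (\<lambda>_. 0)"
    by (auto simp: dd_coboundary_def fun_eq_iff)
  then show ?thesis
    using linear_dd[of "k + 1"] by (auto simp: Vector_Spaces.linear_def module_hom.zero)
qed

section \<open>Weighted inner products and adjointness\<close>

text \<open>
  The inner product of degree \<open>k\<close> in coordinates. As a sum over the oriented cliques it is bilinear
  and symmetric also in the degrees \<open>- 1\<close> and \<open>d + 1\<close>, where the matrices may have any size.
\<close>

definition weighted_inner :: "int \<Rightarrow> 'a cochain \<Rightarrow> 'a cochain \<Rightarrow> real" where
  "weighted_inner k \<phi> \<psi> =
     (\<Sum>i<N k. D k $$ (i, i) / B k $$ (i, i) * \<phi> (\<omega> k ! i) * \<psi> (\<omega> k ! i))"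

lemma cochain_inner_eq:
  assumes k: "0 \<le> k" "k \<le> int d"
  shows "cochain_inner \<omega> B D k = weighted_inner k"
proof (intro ext)
  fix \<phi> \<psi>
  let ?w = "\<lambda>i. D k $$ (i, i) / B k $$ (i, i)"
  have Bi: "inv_mat (B k) = mat_diag (N k) (\<lambda>i. 1 / B k $$ (i, i))"
    by (rule inv_pos_diagonal_mat[OF B[OF k]])
  have "D k * inv_mat (B k) = mat_diag (N k) ?w"
    unfolding Bi by (subst pos_diagonal_mat_eq[OF D[OF k]]) simp
  moreover have "(mat_diag (N k) ?w *\<^sub>v coords \<omega> k \<psi>) $ i = ?w i * \<psi> (\<omega> k ! i)" if "i < N k" for i
    using mat_diag_mult_vec_nth[OF that, of "coords \<omega> k \<psi>"] that by (simp add: coords_def)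
  ultimately show "cochain_inner \<omega> B D k \<phi> \<psi> = weighted_inner k \<phi> \<psi>"
    unfolding cochain_inner_def weighted_inner_def
    by (simp add: scalar_prod_def mat_diag_def coords_def atLeast0LessThan mult_ac)
qed

text \<open>
  The matrices, hence the weights, are arbitrary outside the degrees \<open>0\<close> to \<open>d\<close>, but there the only
  cochain is zero.
\<close>

lemma definite_weighted_inner: "definite_form scale_cochain (cochains K k) (weighted_inner k)"
proof
  show "weighted_inner k (x + y) z = weighted_inner k x z + weighted_inner k y z" for x y z
    by (simp add: weighted_inner_def distrib_left distrib_right sum.distrib)
  show "weighted_inner k (scale_cochain c x) z = c * weighted_inner k x z" for c x z
    by (simp add: weighted_inner_def sum_distrib_left mult_ac)
  show "weighted_inner k x y = weighted_inner k y x" for x y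
    by (simp add: weighted_inner_def mult_ac)
next
  fix x assume x: "x \<in> cochains K k" "x \<noteq> 0"
  then have k: "0 \<le> k" "k \<le> int d"
    using cochains_trivial[OF K, of k] by auto
  let ?f = "\<lambda>i. D k $$ (i, i) / B k $$ (i, i) * x (\<omega> k ! i) * x (\<omega> k ! i)"
  have w: "0 < D k $$ (i, i) / B k $$ (i, i)" if "i < N k" for i
    using diag_pos[OF k that] by simp
  obtain i where i: "i < N k" "x (\<omega> k ! i) \<noteq> 0"
    using cochain_eqI_nth[OF orient x(1) zero_in_cochains] x(2) by auto
  have "0 \<le> ?f j" if "j < N k" for j
    using mult_nonneg_nonneg[OF less_imp_le[OF w[OF that]] zero_le_square[of "x (\<omega> k ! j)"]]
    by (simp only: mult.assoc)
  moreover have "0 < x (\<omega> k ! i) * x (\<omega> k ! i)"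
    using i(2) by (metis not_real_square_gt_zero)
  then have "0 < ?f i"
    using w[OF i(1)] by (metis mult.assoc mult_pos_pos)
  ultimately have "0 < (\<Sum>i<N k. ?f i)"
    using i(1) by (intro sum_pos2[of _ i]) auto
  then show "0 < weighted_inner k x x"
    by (simp add: weighted_inner_def)
qed (rule subspace_cochains)

text \<open>
  In coordinates both sides are the double sum with terms
  $M_{ij} \cdot \phi_j / (B_k)_{jj} \cdot (D_{k+1})_{ii} \psi_i$, where $M$ is the matrix of the
  coboundary: the weight of degree \<open>k + 1\<close> cancels $B_{k+1}$ and that of degree \<open>k\<close> cancels
  $D_k^{-1}$.
\<close>

lemma weighted_inner_adjoint: "weighted_inner (k + 1) (dd k \<phi>) \<psi> = weighted_inner k \<phi> (cod k \<psi>)"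
proof (cases "0 \<le> k \<and> k < int d")
  case True
  then have k: "0 \<le> k" "k < int d"
    by auto
  let ?M = "coboundary_mat K \<omega> k"
  let ?t = "\<lambda>i j. ?M $$ (i, j) * (\<phi> (\<omega> k ! j) / B k $$ (j, j)) * (D (k + 1) $$ (i, i) * \<psi> (\<omega> (k + 1) ! i))"
  have "weighted_inner (k + 1) (dd k \<phi>) \<psi> = (\<Sum>i<N (k + 1). \<Sum>j<N k. ?t i j)"
    unfolding weighted_inner_def
  proof (intro sum.cong refl)
    fix i assume "i \<in> {..<N (k + 1)}"
    then have i: "i < N (k + 1)" by simp
    then have "B (k + 1) $$ (i, i) \<noteq> 0"
      using diag_pos(1)[of "k + 1" i] k by simp
    then show "D (k + 1) $$ (i, i) / B (k + 1) $$ (i, i) * dd k \<phi> (\<omega> (k + 1) ! i) * \<psi> (\<omega> (k + 1) ! i)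
      = (\<Sum>j<N k. ?t i j)"
      by (simp add: dd_nth[OF k i] sum_distrib_left sum_distrib_right mult_ac)
  qed
  also have "\<dots> = (\<Sum>j<N k. \<Sum>i<N (k + 1). ?t i j)"
    by (rule sum.swap)
  also have "\<dots> = weighted_inner k \<phi> (cod k \<psi>)"
    unfolding weighted_inner_def
  proof (intro sum.cong refl)
    fix j assume "j \<in> {..<N k}"
    then have j: "j < N k" by simp
    then have "D k $$ (j, j) \<noteq> 0"
      using diag_pos(2)[of k j] k by simp
    then show "(\<Sum>i<N (k + 1). ?t i j)
      = D k $$ (j, j) / B k $$ (j, j) * \<phi> (\<omega> k ! j) * cod k \<psi> (\<omega> k ! j)"
      by (simp add: cod_nth[OF k j] sum_distrib_left sum_divide_distrib mult_ac)
  qed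
  finally show ?thesis .
next
  case False
  then have "dd k \<phi> = 0" "cod k \<psi> = 0"
    by (auto simp: dd_coboundary_def codifferential_def)
  then show ?thesis
    by (simp add: weighted_inner_def)
qed

lemma adjoint_complex_cochains:
  "adjoint_complex scale_cochain (cochains K (k - 1)) (cochains K k) (cochains K (k + 1))
     (weighted_inner (k - 1)) (weighted_inner k) (weighted_inner (k + 1))
     (dd (k - 1)) (cod (k - 1)) (dd k) (cod k)
     (basis_cochain ` set (\<omega> (k - 1))) (basis_cochain ` set (\<omega> (k + 1)))"
proof (intro adjoint_complex.intro definite_weighted_inner linear_dd linear_cod)
  show "adjoint_complex_axioms scale_cochain (cochains K (k - 1)) (cochains K k) (cochains K (k + 1))
     (weighted_inner (k - 1)) (weighted_inner k) (weighted_inner (k + 1))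
     (dd (k - 1)) (cod (k - 1)) (dd k) (cod k)
     (basis_cochain ` set (\<omega> (k - 1))) (basis_cochain ` set (\<omega> (k + 1)))"
    using span_basis_cochains[OF orient] dd_in_cochains[of "k - 1"] dd_in_cochains[of k]
      cod_in_cochains dd_dd[of "k - 1"] weighted_inner_adjoint[of "k - 1"] weighted_inner_adjoint[of k]
    by unfold_locales simp_all
qed

end

theorem theorem3p3:
  fixes d :: nat and V :: "'a set" and K :: "'a set set"
    and \<omega> :: "int \<Rightarrow> 'a list list" and B D :: "int \<Rightarrow> real mat" and k :: int
  assumes "d \<ge> 1"
    and "clique_complex d V K"
    and "orientation K \<omega>"
    and "\<And>j. 0 \<le> j \<Longrightarrow> j \<le> int d \<Longrightarrow> pos_diagonal_mat (length (\<omega> j)) (B j)"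
    and "\<And>j. 0 \<le> j \<Longrightarrow> j \<le> int d \<Longrightarrow> pos_diagonal_mat (length (\<omega> j)) (D j)"
    and "0 \<le> k" and "k \<le> int d"
  defines "ImD \<equiv> dd_coboundary d K \<omega> B (k - 1) ` cochains K (k - 1)"
    and "Harm \<equiv> {\<phi> \<in> cochains K k. hodge_laplacian d K \<omega> B D k \<phi> = 0}"
    and "ImDstar \<equiv> codifferential d K \<omega> D k ` cochains K (k + 1)"
  shows "direct_sum3 (cochains K k) ImD Harm ImDstar \<and>
    orthogonal_sets (cochain_inner \<omega> B D k) ImD Harm \<and>
    orthogonal_sets (cochain_inner \<omega> B D k) ImD ImDstar \<and>
    orthogonal_sets (cochain_inner \<omega> B D k) Harm ImDstar"
proof -
  interpret data_driven_complex d V K \<omega> B D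
    by unfold_locales (use assms in auto)
  interpret adjoint_complex scale_cochain "cochains K (k - 1)" "cochains K k" "cochains K (k + 1)"
    "weighted_inner (k - 1)" "weighted_inner k" "weighted_inner (k + 1)"
    "dd (k - 1)" "cod (k - 1)" "dd k" "cod k"
    "basis_cochain ` set (\<omega> (k - 1))" "basis_cochain ` set (\<omega> (k + 1))"
    by (rule adjoint_complex_cochains)
  have "Harm = harmonic"
    by (simp add: Harm_def harmonic_def hodge_laplacian_def)
  then show ?thesis
    using hodge_decomposition orthogonal_harmonic orthogonal_images assms(6,7)
    unfolding ImD_def ImDstar_def by (simp add: cochain_inner_eq)
qed

end
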